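(* Let $p$ be an odd prime, let $\sigma\subset\mathbb{C}_p$ be compact and let $\mu\in\mathbf{L}^*(\sigma)$. For every integer $m\ge1$ and every $\lambda\in\mathbb{C}_p$ with $|\lambda|_p$ sufficiently large, $$\zeta_p^\mu(1-m,\lambda)=-\frac{1}{\omega_v^m(\lambda)}\,\frac{B_m^\mu(\lambda)}{m},$$ where $\zeta_p^\mu(s,\lambda)=\frac{1}{s-1}\int_\sigma\langle\lambda+x\rangle^{1-s}\,d\mu(x)$, $B_m^\mu(\lambda)=\int_\sigma(\lambda+x)^m\,d\mu(x)$ and $\omega_v^m(\lambda)=\omega_v(\lambda)^m$.
   Context: Notation. $\mathbb{C}_p$ is the completion of an algebraic closure of $\mathbb{Q}_p$, $|p|_p=p^{-1}$, $v_p$ is the additive valuation with $v_p(p)=1$. Fix a compatible system of fractional powers $p^r\in\mathbb{C}_p$, $r\in\mathbb{Q}$ (with $p^{r+r'}=p^rp^{r'}$ and $p^1=p$). For $a\in\mathbb{C}_p^\times$ write $a=p^{v_p(a)}u$ with $|u|_p=1$, let $\hat a=\lim_{n\to\infty}u^{p^{n!}}$ (the root of unity of order prime to $p$ with $|\hat a-u|_p<1$), and put $\omega_v(a)=p^{v_p(a)}\hat a$ and $\langle a\rangle=a/\omega_v(a)$, so $|\langle a\rangle-1|_p<1$. For $s\in\mathbb{Z}_p$, $\langle a\rangle^s=\sum_{n\ge0}\binom{s}{n}(\langle a\rangle-1)^n$. Locally analytic functions and generalized distributions. For compact $\sigma\subset\mathbb{C}_p$ and $r>0$ let $D_a(r)=\{z\in\mathbb{C}_p:|z-a|_p<r\}$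 and $\mathbb{D}_\sigma(r)=\bigcup_{a\in\sigma}D_a(r)$. $B_r(\sigma)$ is the Banach space of functions $f$ on $\mathbb{D}_\sigma(r)$ given by a convergent power series on each $D_a(r)$, $a\in\sigma$, with finite norm $\|f\|_r=\sup_{z\in\mathbb{D}_\sigma(r)}|f(z)|_p$. $\mathbf{L}(\sigma)$, the space of locally analytic functions on $\sigma$, is the union (inductive limit over $r\to0$, functions being identified if they agree on some $\mathbb{D}_\sigma(r')$) of the $B_r(\sigma)$, with the inductive limit topology. $\mathbf{L}^*(\sigma)$ is the space of continuous $\mathbb{C}_p$-linear maps $\mu:\mathbf{L}(\sigma)\to\mathbb{C}_p$ (generalized distributions); one writes $\int_\sigma f\,d\mu=\mu(f)$. For $|\lambda|_p>\max_{x\in\sigma}|x|_p$ the function $x\mapsto\langle\lambda+x\rangle^{1-s}$ belongs to $\mathbf{L}(\sigma)$. *)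

theory Defs
  imports "HOL-Analysis.Analysis" "HOL-Computational_Algebra.Computational_Algebra"
begin

class nonarchimedean_field = field_char_0 + metric_space +
  fixes absp :: "'a \<Rightarrow> real"
  assumes dist_absp: "dist x y = absp (x - y)"
    and absp_mult: "absp (x * y) = absp x * absp y"
    and absp_add: "absp (x + y) \<le> max (absp x) (absp y)"

definition Qp :: "'a::nonarchimedean_field set" where
  "Qp = closure (range of_rat)"

definition Qp_alg :: "'a::nonarchimedean_field set" where
  "Qp_alg = {x. \<exists>q. q \<noteq> 0 \<and> (\<forall>i. coeff q i \<in> Qp) \<and> poly q x = 0}"

text \<open>
  The type \<open>'a\<close> is a completion of an algebraic closure of the field of p-adic numbers.
  The absolute value restricts to the p-adic absolute value on the rationals, because a multiplicative
  ultrametric absolute value with \<open>|p| = 1/p\<close> is 1 on integers prime to p. As \<open>'a\<close> is complete,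
  the closure of the rationals is their p-adic completion. The elements algebraic over it are
  required to form an algebraically closed field that is dense in \<open>'a\<close>.
\<close>
definition is_Cp :: "nat \<Rightarrow> 'a::nonarchimedean_field itself \<Rightarrow> bool" where
  "is_Cp p _ \<longleftrightarrow>
     prime p \<and>
     absp (of_nat p :: 'a) = 1 / real p \<and>
     complete (UNIV :: 'a set) \<and>
     (\<forall>q :: 'a poly. degree q > 0 \<and> (\<forall>i. coeff q i \<in> Qp_alg) \<longrightarrow> (\<exists>x\<in>Qp_alg. poly q x = 0)) \<and>
     closure (Qp_alg :: 'a set) = UNIV"

definition fractional_powers :: "nat \<Rightarrow> (rat \<Rightarrow> 'a::nonarchimedean_field) \<Rightarrow> bool" where
  "fractional_powers p pw \<longleftrightarrow> (\<forall>r r'. pw (r + r') = pw r * pw r') \<and> pw 1 = of_nat p"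

text \<open>Every nonzero element of a completed algebraic closure has rational valuation.\<close>
definition vp :: "nat \<Rightarrow> 'a::nonarchimedean_field \<Rightarrow> rat" where
  "vp p a = (THE r. absp a = real p powr (- of_rat r))"

definition teichmuller_hat :: "nat \<Rightarrow> (rat \<Rightarrow> 'a) \<Rightarrow> 'a \<Rightarrow> 'a::nonarchimedean_field" where
  "teichmuller_hat p pw a = lim (\<lambda>n. (a / pw (vp p a)) ^ (p ^ fact n))"

definition omega_v :: "nat \<Rightarrow> (rat \<Rightarrow> 'a) \<Rightarrow> 'a \<Rightarrow> 'a::nonarchimedean_field" where
  "omega_v p pw a = pw (vp p a) * teichmuller_hat p pw a"

definition angle_part :: "nat \<Rightarrow> (rat \<Rightarrow> 'a) \<Rightarrow> 'a \<Rightarrow> 'a::nonarchimedean_field" where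
  "angle_part p pw a = a / omega_v p pw a"

text \<open>The exponent \<open>s\<close> is a p-adic integer, regarded as an element of \<open>'a\<close>.\<close>
definition angle_power :: "nat \<Rightarrow> (rat \<Rightarrow> 'a) \<Rightarrow> 'a \<Rightarrow> 'a \<Rightarrow> 'a::nonarchimedean_field" where
  "angle_power p pw a s = (\<Sum>n. (s gchoose n) * (angle_part p pw a - 1) ^ n)"

definition disc_nhd :: "'a::nonarchimedean_field set \<Rightarrow> real \<Rightarrow> 'a set" where
  "disc_nhd \<sigma> r = (\<Union>a\<in>\<sigma>. ball a r)"

text \<open>Functions on \<open>disc_nhd \<sigma> r\<close> are represented as extensional functions.\<close>
definition B_space :: "'a::nonarchimedean_field set \<Rightarrow> real \<Rightarrow> ('a \<Rightarrow> 'a) set" where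
  "B_space \<sigma> r = {f \<in> extensional (disc_nhd \<sigma> r).
     (\<forall>a\<in>\<sigma>. \<exists>c. \<forall>z\<in>ball a r. (\<lambda>n. c n * (z - a) ^ n) sums f z) \<and>
     bdd_above ((\<lambda>z. absp (f z)) ` disc_nhd \<sigma> r)}"

text \<open>The inserted 0 only matters for empty \<open>\<sigma>\<close>.\<close>
definition B_norm :: "'a::nonarchimedean_field set \<Rightarrow> real \<Rightarrow> ('a \<Rightarrow> 'a) \<Rightarrow> real" where
  "B_norm \<sigma> r f = Sup (insert 0 ((\<lambda>z. absp (f z)) ` disc_nhd \<sigma> r))"

definition B_open :: "'a::nonarchimedean_field set \<Rightarrow> real \<Rightarrow> ('a \<Rightarrow> 'a) set \<Rightarrow> bool" where
  "B_open \<sigma> r V \<longleftrightarrow> V \<subseteq> B_space \<sigma> r \<and>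
     (\<forall>f\<in>V. \<exists>e>0. \<forall>g\<in>B_space \<sigma> r. B_norm \<sigma> r (\<lambda>z. g z - f z) < e \<longrightarrow> g \<in> V)"

text \<open>
  Functions that agree on some \<open>disc_nhd \<sigma> r'\<close> are identified by passing to the equivalence
  class. The vector space operations on classes are those of representatives.
\<close>
definition germ :: "'a::nonarchimedean_field set \<Rightarrow> ('a \<Rightarrow> 'a) \<Rightarrow> ('a \<Rightarrow> 'a) set" where
  "germ \<sigma> f = {g. \<exists>r'>0. \<forall>z\<in>disc_nhd \<sigma> r'. g z = f z}"

definition L_space :: "'a::nonarchimedean_field set \<Rightarrow> ('a \<Rightarrow> 'a) set set" where
  "L_space \<sigma> = (\<Union>r\<in>{0<..}. germ \<sigma> ` B_space \<sigma> r)"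

text \<open>
  The inductive limit topology is the finest locally convex topology that makes all the maps
  \<open>B_space \<sigma> r \<rightarrow> L_space \<sigma>\<close> continuous. Its neighbourhoods of 0 are generated by the submodules
  over the unit ball of \<open>'a\<close> whose preimages in all \<open>B_space \<sigma> r\<close> are open.
\<close>
definition L_lattice :: "'a::nonarchimedean_field set \<Rightarrow> ('a \<Rightarrow> 'a) set set \<Rightarrow> bool" where
  "L_lattice \<sigma> M \<longleftrightarrow> M \<subseteq> L_space \<sigma> \<and>
     germ \<sigma> (\<lambda>_. 0) \<in> M \<and>
     (\<forall>f g. germ \<sigma> f \<in> M \<longrightarrow> germ \<sigma> g \<in> M \<longrightarrow> germ \<sigma> (\<lambda>z. f z + g z) \<in> M) \<and>
     (\<forall>c f. absp c \<le> 1 \<longrightarrow> germ \<sigma> f \<in> M \<longrightarrow> germ \<sigma> (\<lambda>z. c * f z) \<in> M) \<and>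
     (\<forall>r>0. B_open \<sigma> r {f \<in> B_space \<sigma> r. germ \<sigma> f \<in> M})"

definition L_open :: "'a::nonarchimedean_field set \<Rightarrow> ('a \<Rightarrow> 'a) set set \<Rightarrow> bool" where
  "L_open \<sigma> U \<longleftrightarrow> U \<subseteq> L_space \<sigma> \<and>
     (\<forall>f. germ \<sigma> f \<in> U \<longrightarrow>
        (\<exists>M. L_lattice \<sigma> M \<and> (\<forall>h. germ \<sigma> h \<in> M \<longrightarrow> germ \<sigma> (\<lambda>z. f z + h z) \<in> U)))"

definition L_topology :: "'a::nonarchimedean_field set \<Rightarrow> ('a \<Rightarrow> 'a) set topology" where
  "L_topology \<sigma> = topology (L_open \<sigma>)"

lemma B_open_Int:
  assumes "B_open \<sigma> r V" "B_open \<sigma> r W"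
  shows "B_open \<sigma> r (V \<inter> W)"
  unfolding B_open_def
proof (intro conjI ballI)
  show "V \<inter> W \<subseteq> B_space \<sigma> r" using assms by (auto simp: B_open_def)
next
  fix f assume f: "f \<in> V \<inter> W"
  obtain d where d: "d > 0" "\<forall>g\<in>B_space \<sigma> r. B_norm \<sigma> r (\<lambda>z. g z - f z) < d \<longrightarrow> g \<in> V"
    using assms(1) f unfolding B_open_def by blast
  obtain e where e: "e > 0" "\<forall>g\<in>B_space \<sigma> r. B_norm \<sigma> r (\<lambda>z. g z - f z) < e \<longrightarrow> g \<in> W"
    using assms(2) f unfolding B_open_def by blast
  show "\<exists>e>0. \<forall>g\<in>B_space \<sigma> r. B_norm \<sigma> r (\<lambda>z. g z - f z) < e \<longrightarrow> g \<in> V \<inter> W"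
    using d e by (intro exI[of _ "min d e"]) auto
qed

lemma L_lattice_Int:
  assumes "L_lattice \<sigma> M" "L_lattice \<sigma> N"
  shows "L_lattice \<sigma> (M \<inter> N)"
proof -
  have eq: "{f \<in> B_space \<sigma> r. germ \<sigma> f \<in> M \<inter> N} =
      {f \<in> B_space \<sigma> r. germ \<sigma> f \<in> M} \<inter> {f \<in> B_space \<sigma> r. germ \<sigma> f \<in> N}" for r
    by auto
  have "B_open \<sigma> r {f \<in> B_space \<sigma> r. germ \<sigma> f \<in> M \<inter> N}" if "r > 0" for r
    unfolding eq using assms that by (intro B_open_Int) (auto simp: L_lattice_def)
  then show ?thesis
    using assms unfolding L_lattice_def by auto
qed

lemma istopology_L_open: "istopology (L_open \<sigma>)"
  unfolding istopology_def
proof (intro conjI allI impI)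
  fix S T assume S: "L_open \<sigma> S" and T: "L_open \<sigma> T"
  show "L_open \<sigma> (S \<inter> T)"
    unfolding L_open_def
  proof (intro conjI allI impI)
    show "S \<inter> T \<subseteq> L_space \<sigma>" using S by (auto simp: L_open_def)
  next
    fix f assume f: "germ \<sigma> f \<in> S \<inter> T"
    obtain M where M: "L_lattice \<sigma> M" "\<forall>h. germ \<sigma> h \<in> M \<longrightarrow> germ \<sigma> (\<lambda>z. f z + h z) \<in> S"
      using S f unfolding L_open_def by blast
    obtain N where N: "L_lattice \<sigma> N" "\<forall>h. germ \<sigma> h \<in> N \<longrightarrow> germ \<sigma> (\<lambda>z. f z + h z) \<in> T"
      using T f unfolding L_open_def by blast
    show "\<exists>M. L_lattice \<sigma> M \<and> (\<forall>h. germ \<sigma> h \<in> M \<longrightarrow> germ \<sigma> (\<lambda>z. f z + h z) \<in> S \<inter> T)"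
      using M N L_lattice_Int by blast
  qed
next
  fix K assume "\<forall>U\<in>K. L_open \<sigma> U"
  then show "L_open \<sigma> (\<Union>K)"
    unfolding L_open_def by (meson Sup_le_iff Union_iff)
qed

lemma openin_L_topology: "openin (L_topology \<sigma>) U \<longleftrightarrow> L_open \<sigma> U"
  by (simp add: L_topology_def istopology_L_open)

text \<open>The elements of the dual space, that is, the generalized distributions on \<open>\<sigma>\<close>.\<close>
definition L_dual :: "'a::nonarchimedean_field set \<Rightarrow> (('a \<Rightarrow> 'a) set \<Rightarrow> 'a) set" where
  "L_dual \<sigma> = {\<mu>.
     (\<forall>f g. germ \<sigma> f \<in> L_space \<sigma> \<longrightarrow> germ \<sigma> g \<in> L_space \<sigma> \<longrightarrow>
        \<mu> (germ \<sigma> (\<lambda>z. f z + g z)) = \<mu> (germ \<sigma> f) + \<mu> (germ \<sigma> g)) \<and>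
     (\<forall>c f. germ \<sigma> f \<in> L_space \<sigma> \<longrightarrow> \<mu> (germ \<sigma> (\<lambda>z. c * f z)) = c * \<mu> (germ \<sigma> f)) \<and>
     continuous_map (L_topology \<sigma>) euclidean \<mu>}"

definition dist_integral ::
  "'a::nonarchimedean_field set \<Rightarrow> (('a \<Rightarrow> 'a) set \<Rightarrow> 'a) \<Rightarrow> ('a \<Rightarrow> 'a) \<Rightarrow> 'a" where
  "dist_integral \<sigma> \<mu> f = \<mu> (germ \<sigma> f)"

definition zeta_mu ::
  "nat \<Rightarrow> (rat \<Rightarrow> 'a) \<Rightarrow> 'a set \<Rightarrow> (('a \<Rightarrow> 'a) set \<Rightarrow> 'a) \<Rightarrow> 'a \<Rightarrow> 'a \<Rightarrow> 'a::nonarchimedean_field" where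
  "zeta_mu p pw \<sigma> \<mu> s l =
     1 / (s - 1) * dist_integral \<sigma> \<mu> (\<lambda>x. angle_power p pw (l + x) (1 - s))"

definition bernoulli_mu ::
  "'a set \<Rightarrow> (('a \<Rightarrow> 'a) set \<Rightarrow> 'a) \<Rightarrow> nat \<Rightarrow> 'a \<Rightarrow> 'a::nonarchimedean_field" where
  "bernoulli_mu \<sigma> \<mu> m l = dist_integral \<sigma> \<mu> (\<lambda>x. (l + x) ^ m)"

end

theory Submission
  imports Defs
begin

text \<open>
  If \<open>\<bar>x\<bar> < \<bar>\<lambda>\<bar>\<close> then \<open>\<bar>\<lambda> + x\<bar> = \<bar>\<lambda>\<bar>\<close> and \<open>\<bar>(\<lambda> + x) / \<lambda> - 1\<bar> < 1\<close>. The \<open>p\<close>-th power map contracts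
  the distance of congruent elements of absolute value at most 1, so the sequences that define the
  two Teichmueller representatives have the same limit and \<open>\<omega>\<^sub>v(\<lambda> + x) = \<omega>\<^sub>v(\<lambda>)\<close>. For \<open>s = 1 - m\<close> the
  binomial series is the finite expansion of \<open>\<langle>\<lambda> + x\<rangle>\<^sup>m = (\<lambda> + x)\<^sup>m / \<omega>\<^sub>v(\<lambda>)\<^sup>m\<close>, and the constant
  denominator leaves the integral by linearity.
\<close>

section \<open>Ultrametric absolute values\<close>

context nonarchimedean_field
begin

lemma absp_nonneg [simp]: "absp x \<ge> 0"
  using zero_le_dist[of x 0] by (simp add: dist_absp)

lemma absp_eq_0_iff [simp]: "absp x = 0 \<longleftrightarrow> x = 0"
  using dist_eq_0_iff[of x 0] by (simp add: dist_absp)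

lemma absp_0 [simp]: "absp 0 = 0"
  by simp

lemma absp_1 [simp]: "absp 1 = 1"
  using absp_mult[of 1 1] by simp

lemma absp_minus [simp]: "absp (- x) = absp x"
  using dist_commute[of 0 x] by (simp add: dist_absp)

lemma absp_power [simp]: "absp (x ^ n) = absp x ^ n"
  by (induction n) (simp_all add: absp_mult)

lemma absp_divide: "absp (x / y) = absp x / absp y"
proof (cases "y = 0")
  case False
  then have "absp x = absp (x / y) * absp y"
    by (simp flip: absp_mult)
  then show ?thesis using False by (simp add: field_simps)
qed simp

lemma absp_of_nat_le_1: "absp (of_nat n) \<le> 1"
proof (induction n)
  case (Suc n)
  then show ?case using absp_add[of 1 "of_nat n"] by simp
qed simp

lemma absp_sum_le:
  assumes "\<And>i. i \<in> A \<Longrightarrow> absp (f i) \<le> B" "B \<ge> 0"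
  shows "absp (sum f A) \<le> B"
  using assms
proof (induction A rule: infinite_finite_induct)
  case (insert i A)
  then have "max (absp (f i)) (absp (sum f A)) \<le> B" by simp
  then show ?case using insert.hyps order_trans[OF absp_add[of "f i" "sum f A"]] by simp
qed simp_all

lemma absp_add_eq:
  assumes "absp x < absp l"
  shows "absp (l + x) = absp l"
proof (rule antisym)
  show "absp (l + x) \<le> absp l" using absp_add[of l x] assms by simp
  \<comment> \<open>Since \<open>l = (l + x) + (- x)\<close> and \<open>absp x < absp l\<close>, the
    maximum in the ultrametric inequality must be \<open>absp (l + x)\<close>.\<close>
  show "absp l \<le> absp (l + x)" using absp_add[of "l + x" "- x"] assms by simp
qed

end

text \<open>Every term of the expansion of \<open>(u + d) ^ p - u ^ p\<close> keeps one factor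
  \<open>d\<close> and gains a factor of size at most \<rho>: from \<open>p\<close> dividing the
  middle binomial coefficients, from a further \<open>d\<close> in the top term. One \<rho> bounding
  both \<open>p\<close> and \<open>d\<close> gives a ratio that survives iteration.\<close>

lemma absp_power_prime_diff_le:
  fixes u d :: "'a::nonarchimedean_field"
  assumes p: "prime p" "absp (of_nat p :: 'a) \<le> \<rho>"
    and u: "absp u \<le> 1" and d: "absp d \<le> \<rho>" and rho: "\<rho> \<le> 1"
  shows "absp ((u + d) ^ p - u ^ p) \<le> \<rho> * absp d"
proof -
  have "(u + d) ^ p = (\<Sum>k\<le>p. of_nat (p choose k) * d ^ k * u ^ (p - k))"
    using binomial_ring[of d u p] by (simp add: add.commute)
  also have "\<dots> = u ^ p + (\<Sum>k\<in>{1..p}. of_nat (p choose k) * d ^ k * u ^ (p - k))"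
    by (subst sum.remove[of _ 0]) (auto intro!: sum.cong)
  finally have eq: "(u + d) ^ p - u ^ p = (\<Sum>k\<in>{1..p}. of_nat (p choose k) * d ^ k * u ^ (p - k))"
    by simp
  have rho0: "\<rho> \<ge> 0" using d order_trans[OF absp_nonneg] by blast
  have "absp (of_nat (p choose k) * d ^ k * u ^ (p - k)) \<le> \<rho> * absp d" if k: "k \<in> {1..p}" for k
  proof -
    have d_power: "absp d * absp d ^ (k - 1) = absp d ^ k" using k by (cases k) auto
    \<comment> \<open>With one factor \<open>absp d\<close> set aside, the rest must be at most
      \<rho>. For \<open>k = p\<close> the coefficient is 1, and \<open>p - 1 \<ge> 1\<close>
      factors of \<open>d\<close> remain.\<close>
    have "absp (of_nat (p choose k) :: 'a) * absp d ^ (k - 1) \<le> \<rho>"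
    proof (cases "k = p")
      case True
      have "absp d ^ (p - 1) \<le> absp d ^ 1"
        using d rho prime_ge_2_nat[OF p(1)] by (intro power_decreasing) auto
      then show ?thesis using True d by simp
    next
      case False
      then have "p dvd (p choose k)"
        using k p(1) by (intro dvd_choose_prime) auto
      then obtain j where "p choose k = p * j" by blast
      then have "absp (of_nat (p choose k) :: 'a) = absp (of_nat p :: 'a) * absp (of_nat j :: 'a)"
        by (simp add: absp_mult)
      also have "\<dots> \<le> \<rho> * 1"
        using p(2) rho0 absp_of_nat_le_1 by (intro mult_mono) auto
      finally have "absp (of_nat (p choose k) :: 'a) \<le> \<rho>" by simp
      moreover have "absp d ^ (k - 1) \<le> 1"
        using d rho by (intro power_le_one) auto
      ultimately have "absp (of_nat (p choose k) :: 'a) * absp d ^ (k - 1) \<le> \<rho> * 1"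
        using rho0 by (intro mult_mono) auto
      then show ?thesis by simp
    qed
    moreover have "absp u ^ (p - k) \<le> 1" using u by (intro power_le_one) auto
    ultimately have "absp (of_nat (p choose k) :: 'a) * absp d ^ (k - 1) * absp u ^ (p - k) * absp d
        \<le> \<rho> * 1 * absp d"
      using rho0 by (intro mult_mono) auto
    then show ?thesis
      by (simp add: absp_mult mult_ac flip: d_power)
  qed
  then show ?thesis
    unfolding eq using rho0 by (intro absp_sum_le) auto
qed

lemma prime_power_iterates_dist_tendsto_0:
  fixes u u' :: "'a::nonarchimedean_field"
  assumes p: "prime p" "absp (of_nat p :: 'a) < 1" and u: "absp u \<le> 1" "absp (u' - u) < 1"
  shows "(\<lambda>n. dist (u' ^ (p ^ n)) (u ^ (p ^ n))) \<longlonglongrightarrow> 0"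
proof -
  define \<rho> where "\<rho> = max (absp (of_nat p :: 'a)) (absp (u' - u))"
  have rho: "0 \<le> \<rho>" "\<rho> < 1" "absp (of_nat p :: 'a) \<le> \<rho>" "absp (u' - u) \<le> \<rho>"
    using p u by (auto simp: \<rho>_def le_max_iff_disj)
  \<comment> \<open>The exponent is \<open>Suc n\<close> because the initial difference is already
    at most \<rho>. Hence each difference stays at most \<rho>, as the contraction estimate
    requires.\<close>
  have le: "absp (u' ^ (p ^ n) - u ^ (p ^ n)) \<le> \<rho> ^ Suc n" for n
  proof (induction n)
    case (Suc n)
    let ?d = "u' ^ (p ^ n) - u ^ (p ^ n)"
    have "\<rho> ^ Suc n \<le> \<rho>" using rho by (simp add: mult_left_le power_le_one)
    then have "absp ((u ^ (p ^ n) + ?d) ^ p - (u ^ (p ^ n)) ^ p) \<le> \<rho> * absp ?d"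
      using Suc rho p u by (intro absp_power_prime_diff_le) (auto intro: power_le_one)
    also have "\<dots> \<le> \<rho> * \<rho> ^ Suc n" using Suc rho by (intro mult_left_mono) auto
    finally show ?case by (simp add: power_mult [symmetric] mult.commute)
  qed (use rho in simp)
  have "(\<lambda>n. \<rho> ^ Suc n) \<longlonglongrightarrow> 0"
    using rho by (intro LIMSEQ_Suc LIMSEQ_realpow_zero) auto
  then show ?thesis
    by (rule tendsto_sandwich[OF _ _ tendsto_const, rotated 2]) (use le in \<open>auto simp: dist_absp\<close>)
qed

text \<open>A convergent sequence is bounded, whereas these powers have unbounded absolute
  value.\<close>

lemma prime_power_iterates_not_convergent:
  fixes u :: "'a::nonarchimedean_field"
  assumes "p \<ge> 2" "absp u > 1"
  shows "\<not> (\<lambda>n. u ^ (p ^ fact n)) \<longlonglongrightarrow> L"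
proof
  assume "(\<lambda>n. u ^ (p ^ fact n)) \<longlonglongrightarrow> L"
  then have "bounded (range (\<lambda>n. u ^ (p ^ fact n)))"
    by (rule convergent_imp_bounded)
  then obtain K where K: "\<And>n. dist 0 (u ^ (p ^ fact n)) \<le> K"
    unfolding bounded_any_center[of _ 0] by auto
  obtain n where "K < absp u ^ n" using real_arch_pow[OF assms(2)] by blast
  also have "n \<le> p ^ fact n"
    using fact_ge_self[of n] less_exp[of "fact n"] power_mono[OF assms(1), of "fact n"] by linarith
  then have "absp u ^ n \<le> absp u ^ (p ^ fact n)"
    using assms by (intro power_increasing) auto
  finally show False using K[of n] by (simp add: dist_absp)
qed

text \<open>Both sequences have the same set of limits, and \<open>lim\<close> is a definite
  description depending only on that set. Thus Teichmueller limits can be compared without proving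
  that they exist.\<close>

lemma lim_eq_of_dist_tendsto_0:
  fixes X Y :: "nat \<Rightarrow> 'a::metric_space"
  assumes "(\<lambda>n. dist (X n) (Y n)) \<longlonglongrightarrow> 0"
  shows "lim X = lim Y"
proof -
  have *: "V \<longlonglongrightarrow> L" if "U \<longlonglongrightarrow> L" and UV: "(\<lambda>n. dist (U n) (V n)) \<longlonglongrightarrow> 0"
    for U V :: "nat \<Rightarrow> 'a" and L
  proof -
    have "(\<lambda>n. dist (U n) (V n) + dist (U n) L) \<longlonglongrightarrow> 0"
      using tendsto_add[OF UV] that(1) by (subst (asm) tendsto_dist_iff) fastforce
    then have "(\<lambda>n. dist (V n) L) \<longlonglongrightarrow> 0"
      by (rule tendsto_sandwich[OF _ _ tendsto_const, rotated 2])
        (auto intro!: always_eventually dist_triangle3)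
    then show ?thesis by (subst tendsto_dist_iff)
  qed
  have "X \<longlonglongrightarrow> L \<longleftrightarrow> Y \<longlonglongrightarrow> L" for L
    using *[of X L Y] *[of Y L X] assms by (auto simp: dist_commute)
  then show ?thesis by (simp add: lim_def)
qed

section \<open>Invariance of the Teichmueller factor\<close>

lemma vp_cong: "absp a = absp b \<Longrightarrow> vp p a = vp p b"
  by (simp add: vp_def)

text \<open>
  No rationality of the valuation is needed: if \<open>\<bar>a / pw (vp p a)\<bar> > 1\<close>, then neither sequence
  converges and both limits are the same junk value.
\<close>
lemma teichmuller_hat_add:
  fixes l x :: "'a::nonarchimedean_field"
  assumes p: "prime p" "absp (of_nat p :: 'a) < 1" and x: "absp x < absp l"
  shows "teichmuller_hat p pw (l + x) = teichmuller_hat p pw l"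
proof -
  define c where "c = pw (vp p l)"
  have vp: "vp p (l + x) = vp p l" using absp_add_eq[OF x] by (rule vp_cong)
  have "lim (\<lambda>n. ((l + x) / c) ^ (p ^ fact n)) = lim (\<lambda>n. (l / c) ^ (p ^ fact n))"
  proof (cases "absp (l / c) \<le> 1")
    case True
    have "absp ((l + x) / c - l / c) = absp x / absp c"
      by (simp add: add_divide_distrib absp_divide)
    also have "\<dots> < 1"
    proof (cases "c = 0")
      case False
      then have "absp x / absp c < absp l / absp c"
        using x absp_nonneg[of c] by (intro divide_strict_right_mono) (auto simp: less_le)
      then show ?thesis using True by (simp add: absp_divide)
    qed simp
    finally have "(\<lambda>n. dist (((l + x) / c) ^ (p ^ n)) ((l / c) ^ (p ^ n))) \<longlonglongrightarrow> 0"
      using p True by (intro prime_power_iterates_dist_tendsto_0)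
    \<comment> \<open>The exponents \<open>p ^ fact n\<close> pick a subsequence of the iterates
      \<open>p ^ n\<close>.\<close>
    moreover have "filterlim (fact :: nat \<Rightarrow> nat) sequentially sequentially"
      by (rule filterlim_at_top_mono[OF filterlim_ident]) (auto intro!: always_eventually fact_ge_self)
    ultimately show ?thesis
      by (intro lim_eq_of_dist_tendsto_0) (rule filterlim_compose)
  next
    case False
    then have "absp (l / c) > 1" "absp ((l + x) / c) > 1"
      using absp_add_eq[OF x] by (simp_all add: absp_divide)
    with prime_power_iterates_not_convergent[OF prime_ge_2_nat[OF p(1)]]
    have "\<not> (\<lambda>n. ((l + x) / c) ^ (p ^ fact n)) \<longlonglongrightarrow> L"
      "\<not> (\<lambda>n. (l / c) ^ (p ^ fact n)) \<longlonglongrightarrow> L" for L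
      by blast+
    then show ?thesis by (simp add: lim_def)
  qed
  then show ?thesis by (simp add: teichmuller_hat_def vp c_def)
qed

lemma omega_v_add:
  fixes l x :: "'a::nonarchimedean_field"
  assumes "prime p" "absp (of_nat p :: 'a) < 1" "absp x < absp l"
  shows "omega_v p pw (l + x) = omega_v p pw l"
  using teichmuller_hat_add[OF assms] vp_cong[OF absp_add_eq[OF assms(3)], of p]
  by (simp add: omega_v_def)

text \<open>The binomial coefficients vanish for \<open>n > m\<close>, leaving the binomial theorem
  for \<open>(?t + 1) ^ m\<close>.\<close>

lemma angle_power_of_nat: "angle_power p pw a (of_nat m) = angle_part p pw a ^ m"
proof -
  let ?t = "angle_part p pw a - 1"
  have "(\<lambda>n. (of_nat m gchoose n) * ?t ^ n) sums (\<Sum>n\<le>m. (of_nat m gchoose n) * ?t ^ n)"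
    by (rule sums_finite) (auto simp flip: binomial_gbinomial)
  then have "angle_power p pw a (of_nat m) = (\<Sum>n\<le>m. of_nat (m choose n) * ?t ^ n * 1 ^ (m - n))"
    by (simp add: angle_power_def sums_unique [symmetric] binomial_gbinomial)
  also have "\<dots> = angle_part p pw a ^ m"
    by (subst binomial_ring [symmetric]) simp
  finally show ?thesis .
qed

section \<open>Germs of powers\<close>

lemma germ_cong:
  assumes "r > 0" "\<And>z. z \<in> disc_nhd \<sigma> r \<Longrightarrow> f z = g z"
  shows "germ \<sigma> f = germ \<sigma> g"
proof -
  have "germ \<sigma> u \<subseteq> germ \<sigma> v" if uv: "\<And>z. z \<in> disc_nhd \<sigma> r \<Longrightarrow> u z = v z" for u v :: "'a \<Rightarrow> 'a"
  proof
    fix h assume "h \<in> germ \<sigma> u"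
    then obtain r' where "r' > 0" "\<And>z. z \<in> disc_nhd \<sigma> r' \<Longrightarrow> h z = u z"
      by (auto simp: germ_def)
    then show "h \<in> germ \<sigma> v"
      using uv assms(1) by (force simp: germ_def disc_nhd_def intro!: exI[of _ "min r r'"])
  qed
  then show ?thesis using assms(2) by (metis subset_antisym)
qed

text \<open>Linearity in \<open>L_dual\<close> is available only for germs in
  \<open>L_space\<close>. A power of \<open>l + x\<close> is a polynomial, so radius 1 already
  serves, and the bound on the neighbourhood makes the norm finite.\<close>

lemma germ_power_in_L_space:
  fixes l :: "'a::nonarchimedean_field"
  assumes bdd: "\<And>z. z \<in> disc_nhd \<sigma> 1 \<Longrightarrow> absp z \<le> K"
  shows "germ \<sigma> (\<lambda>x. (l + x) ^ m) \<in> L_space \<sigma>"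
proof -
  \<comment> \<open>Members of \<open>B_space\<close> are extensional; restricting does not change
    the germ.\<close>
  let ?f = "restrict (\<lambda>x. (l + x) ^ m) (disc_nhd \<sigma> 1)"
  have "\<exists>c. \<forall>z\<in>ball a 1. (\<lambda>n. c n * (z - a) ^ n) sums ?f z" if a: "a \<in> \<sigma>" for a
  proof (intro exI ballI)
    fix z assume "z \<in> ball a 1"
    then have "?f z = ((z - a) + (l + a)) ^ m" using a by (auto simp: disc_nhd_def add_ac)
    also have "\<dots> = (\<Sum>n\<le>m. of_nat (m choose n) * (l + a) ^ (m - n) * (z - a) ^ n)"
      by (subst binomial_ring) (simp add: mult_ac)
    \<comment> \<open>This fixes the witness \<open>c\<close>: the Taylor coefficients at
      \<open>a\<close>, which are zero for \<open>n > m\<close>.\<close>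
    finally show "(\<lambda>n. of_nat (m choose n) * (l + a) ^ (m - n) * (z - a) ^ n) sums ?f z"
      by (simp only:) (rule sums_finite, auto)
  qed
  moreover have "absp (?f z) \<le> max (absp l) K ^ m" if z: "z \<in> disc_nhd \<sigma> 1" for z
    using z absp_add[of l z] bdd[OF z] by (auto intro!: power_mono)
  then have "bdd_above ((\<lambda>z. absp (?f z)) ` disc_nhd \<sigma> 1)"
    by (intro bdd_aboveI2)
  ultimately have "?f \<in> B_space \<sigma> 1"
    by (simp add: B_space_def)
  moreover have "germ \<sigma> ?f = germ \<sigma> (\<lambda>x. (l + x) ^ m)"
    by (rule germ_cong[of 1]) auto
  ultimately show ?thesis
    unfolding L_space_def by (intro UN_I[of 1]) (auto intro: image_eqI[of _ _ ?f])
qed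

lemma compact_disc_nhd_absp_bounded:
  fixes \<sigma> :: "'a::nonarchimedean_field set"
  assumes "compact \<sigma>"
  obtains K where "\<And>z. z \<in> disc_nhd \<sigma> r \<Longrightarrow> absp z \<le> K"
proof -
  obtain K where K: "\<And>a. a \<in> \<sigma> \<Longrightarrow> dist 0 a \<le> K"
    using compact_imp_bounded[OF assms] unfolding bounded_any_center[of _ 0] by auto
  show ?thesis
  proof
    fix z assume "z \<in> disc_nhd \<sigma> r"
    then obtain a where a: "a \<in> \<sigma>" "dist a z < r" by (auto simp: disc_nhd_def)
    then have "dist 0 z \<le> K + r" using K[of a] dist_triangle[of 0 z a] by linarith
    then show "absp z \<le> K + r" by (simp add: dist_absp)
  qed
qed

theorem theorem3p6:
  fixes p :: nat
    and pw :: "rat \<Rightarrow> 'a::nonarchimedean_field"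
    and \<sigma> :: "'a set"
    and \<mu> :: "('a \<Rightarrow> 'a) set \<Rightarrow> 'a"
  assumes "is_Cp p TYPE('a)"
    and "odd p"
    and "fractional_powers p pw"
    and "compact \<sigma>"
    and "\<mu> \<in> L_dual \<sigma>"
  shows "\<exists>R. \<forall>m\<ge>1. \<forall>l. absp l > R \<longrightarrow>
           zeta_mu p pw \<sigma> \<mu> (1 - of_nat m) l =
             - (1 / omega_v p pw l ^ m) * (bernoulli_mu \<sigma> \<mu> m l / of_nat m)"
proof -
  have p: "prime p" using assms(1) by (simp add: is_Cp_def)
  have absp_p: "absp (of_nat p :: 'a) < 1"
    using assms(1) prime_gt_1_nat[OF p] by (simp add: is_Cp_def)
  \<comment> \<open>\<open>R\<close> bounds a whole neighbourhood of \<sigma>, since germs are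
    compared there, and it is chosen before \<open>m\<close>, so one bound serves all
    \<open>m\<close>.\<close>
  obtain R where R: "\<And>z. z \<in> disc_nhd \<sigma> 1 \<Longrightarrow> absp z \<le> R"
    using compact_disc_nhd_absp_bounded[OF assms(4), where r = 1] by blast
  have "zeta_mu p pw \<sigma> \<mu> (1 - of_nat m) l =
      - (1 / omega_v p pw l ^ m) * (bernoulli_mu \<sigma> \<mu> m l / of_nat m)"
    if l: "absp l > R" for m l
  proof -
    have "angle_power p pw (l + z) (of_nat m) = 1 / omega_v p pw l ^ m * (l + z) ^ m"
      if z: "z \<in> disc_nhd \<sigma> 1" for z
      using omega_v_add[OF p absp_p order.strict_trans1[OF R[OF z] l], of pw]
      by (simp add: angle_power_of_nat angle_part_def power_divide)
    then have "germ \<sigma> (\<lambda>x. angle_power p pw (l + x) (of_nat m)) =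
        germ \<sigma> (\<lambda>x. 1 / omega_v p pw l ^ m * (l + x) ^ m)"
      by (intro germ_cong[of 1]) auto
    moreover have "\<mu> (germ \<sigma> (\<lambda>x. 1 / omega_v p pw l ^ m * (l + x) ^ m)) =
        1 / omega_v p pw l ^ m * \<mu> (germ \<sigma> (\<lambda>x. (l + x) ^ m))"
      using assms(5) germ_power_in_L_space[OF R] unfolding L_dual_def by blast
    \<comment> \<open>For \<open>s = 1 - of_nat m\<close>, \<open>1 - s\<close> is
      \<open>of_nat m\<close>, and \<open>1 / (s - 1)\<close> supplies the sign and the denominator
      \<open>of_nat m\<close>.\<close>
    ultimately show ?thesis
      by (simp add: zeta_mu_def bernoulli_mu_def dist_integral_def)
  qed
  then show ?thesis by blast
qed

end
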